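(* There is an absolute constant $C>0$ such that the following holds. Let $G$ be a graph on $n+1$ vertices, and let $H$ be obtained from $G$ by deleting one vertex. Then $r(G) \leq C\sqrt{n\log n}\cdot r(H)$.
   Context: For a graph $F$, the Ramsey number $r(F)$ is the minimum $N$ such that every two-coloring of the edges of the complete graph $K_N$ contains a monochromatic copy of $F$. Logarithms are to base $2$.
   Formalization: The bound is stated for n ≥ 2 only, since for n = 1 the right-hand side is 0 and the claim fails (G with two vertices has r(G) = 2), and for n = 0 log n is undefined; vertices are taken to be natural numbers, which covers every finite graph up to isomorphism. *)

theory Defs
  imports Complex_Main
begin

definition simple_graph :: "'a set \<Rightarrow> 'a set set \<Rightarrow> bool" where
  "simple_graph V E \<longleftrightarrow> finite V \<and> (\<forall>e\<in>E. e \<subseteq> V \<and> card e = 2)"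

text \<open>A two-colouring of the edges of K_N (vertices {..<N}) is a map c from
  2-element sets to bool.  A monochromatic copy of (V,E) of colour col is an
  injective map of V into {..<N} sending every edge to an edge of colour col.\<close>
definition mono_copy :: "nat \<Rightarrow> (nat set \<Rightarrow> bool) \<Rightarrow> 'a set \<Rightarrow> 'a set set \<Rightarrow> bool \<Rightarrow> bool" where
  "mono_copy N c V E col \<longleftrightarrow>
     (\<exists>f. inj_on f V \<and> f ` V \<subseteq> {..<N} \<and> (\<forall>e\<in>E. c (f ` e) = col))"

definition ramsey_number :: "'a set \<Rightarrow> 'a set set \<Rightarrow> nat" where
  "ramsey_number V E = (LEAST N. \<forall>c :: nat set \<Rightarrow> bool. \<exists>col. mono_copy N c V E col)"

definition delete_vertex_edges :: "'a set set \<Rightarrow> 'a \<Rightarrow> 'a set set" where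
  "delete_vertex_edges E v = {e \<in> E. v \<notin> e}"

end

theory Submission
  imports Defs "HOL-Library.FuncSet"
begin

text \<open>Let r be the Ramsey number of H and colour the complete graph on K r vertices, with K of order
  sqrt (n log n), without a monochromatic copy of G.  The red neighbourhood of u meets the blue
  neighbourhood of w in fewer than r vertices, since otherwise it contains a monochromatic H which u
  or w extends to G.  So all red neighbourhoods almost agree, and double counting forces one colour,
  say red, to have maximum degree at most 3 r.  A greedy embedding of G into blue fails, hence H has a
  subgraph of minimum degree of order K, and a random colouring shows that log r is at least of
  order K.  On the other hand there is no clique on n + 1 vertices in either colour; an exchange
  argument in the style of Erdos and Szemeredi, applied to a maximum blue clique, then bounds log r
  by order (n / K) log n.  The two bounds contradict each other for this K.\<close>

section \<open>Copies, neighbourhoods and cliques inside a set of vertices\<close>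

text \<open>The host is an arbitrary set \<open>S\<close> and not only an initial segment, so that
  copies can be sought inside neighbourhoods.\<close>

definition copy_in :: "(nat set \<Rightarrow> bool) \<Rightarrow> bool \<Rightarrow> nat set \<Rightarrow> 'a set \<Rightarrow> 'a set set \<Rightarrow> bool" where
  "copy_in c col S V E \<longleftrightarrow> (\<exists>f. inj_on f V \<and> f ` V \<subseteq> S \<and> (\<forall>e\<in>E. c (f ` e) = col))"

text \<open>A colouring also assigns a value to the singleton \<open>{x, x}\<close>; requiring
  \<open>y \<noteq> x\<close> keeps that meaningless value out.\<close>

definition nbrs :: "(nat set \<Rightarrow> bool) \<Rightarrow> bool \<Rightarrow> nat set \<Rightarrow> nat \<Rightarrow> nat set" where
  "nbrs c col S x = {y \<in> S. y \<noteq> x \<and> c {x, y} = col}"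

definition clique :: "(nat set \<Rightarrow> bool) \<Rightarrow> bool \<Rightarrow> nat set \<Rightarrow> bool" where
  "clique c col Q \<longleftrightarrow> (\<forall>x\<in>Q. \<forall>y\<in>Q. x \<noteq> y \<longrightarrow> c {x, y} = col)"

lemma mono_copy_iff_copy_in: "mono_copy N c V E col \<longleftrightarrow> copy_in c col {..<N} V E"
  by (simp add: mono_copy_def copy_in_def)

lemma copy_in_mono: "copy_in c col S V E \<Longrightarrow> S \<subseteq> T \<Longrightarrow> copy_in c col T V E"
  unfolding copy_in_def by (meson subset_trans)

lemma finite_nbrs [simp]: "finite S \<Longrightarrow> finite (nbrs c col S x)"
  by (simp add: nbrs_def)

lemma simple_graph_finite: "simple_graph V E \<Longrightarrow> finite V"
  by (simp add: simple_graph_def)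

lemma simple_graph_edge:
  assumes "simple_graph V E" "e \<in> E"
  obtains x y where "e = {x, y}" "x \<noteq> y" "x \<in> V" "y \<in> V"
proof -
  have "e \<subseteq> V" "card e = 2" using assms by (auto simp: simple_graph_def)
  then show ?thesis using that by (auto simp: card_2_iff)
qed

lemma clique_copy_in:
  assumes "simple_graph V E" "clique c col Q" "finite Q" "card V \<le> card Q" "Q \<subseteq> S"
  shows "copy_in c col S V E"
proof -
  obtain f where f: "inj_on f V" "f ` V \<subseteq> Q"
    using card_le_inj[OF simple_graph_finite[OF assms(1)] assms(3,4)] by auto
  have "c (f ` e) = col" if e: "e \<in> E" for e
  proof -
    obtain x y where "e = {x, y}" "x \<noteq> y" "x \<in> V" "y \<in> V"
      using simple_graph_edge[OF assms(1) e] by blast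
    moreover from this f have "f x \<noteq> f y" "f x \<in> Q" "f y \<in> Q"
      by (auto simp: inj_on_def)
    ultimately show ?thesis using assms(2) by (simp add: clique_def)
  qed
  with f assms(5) show ?thesis unfolding copy_in_def by blast
qed

lemma maximum_clique:
  assumes "finite S"
  obtains A where "A \<subseteq> S" "clique c col A"
    "\<And>B. B \<subseteq> S \<Longrightarrow> clique c col B \<Longrightarrow> card B \<le> card A"
proof -
  let ?P = "\<lambda>A. A \<subseteq> S \<and> clique c col A"
  have "\<forall>A. ?P A \<longrightarrow> card A < card S + 1"
    using card_mono[OF assms] by (simp add: less_Suc_eq_le)
  moreover have "?P {}" by (simp add: clique_def)
  ultimately obtain A where "?P A" "\<forall>B. ?P B \<longrightarrow> card B \<le> card A"
    using ex_has_greatest_nat[of ?P "{}" card "card S + 1"] by blast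
  then show ?thesis using that by blast
qed

text \<open>By maximality of a largest clique \<open>A\<close> of colour \<open>col\<close>, every
  vertex outside \<open>A\<close> sends an edge of the other colour to \<open>A\<close>. Since
  \<open>A\<close> has at most \<open>n\<close> vertices, some \<open>q\<close> in \<open>A\<close>
  has a large neighbourhood in the other colour. Passing to it costs a factor \<open>n + 1\<close>
  and gains the vertex \<open>q\<close>.\<close>

lemma clique_or_clique:
  assumes "finite W" "\<And>Q. Q \<subseteq> W \<Longrightarrow> clique c col Q \<Longrightarrow> card Q \<le> n" "(n + 1) ^ b \<le> card W"
  shows "\<exists>Q\<subseteq>W. card Q = b + 1 \<and> clique c (\<not> col) Q"
  using assms
proof (induction b arbitrary: W)
  case 0
  then obtain x where "x \<in> W" by fastforce
  then show ?case by (intro exI[of _ "{x}"]) (auto simp: clique_def)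
next
  case (Suc b)
  obtain A where A: "A \<subseteq> W" "clique c col A"
    "\<And>B. B \<subseteq> W \<Longrightarrow> clique c col B \<Longrightarrow> card B \<le> card A"
    using maximum_clique[OF Suc.prems(1)] by metis
  have fA: "finite A" using A(1) Suc.prems(1) finite_subset by blast
  have cA: "card A \<le> n" using Suc.prems(2) A by blast
  have sub: "W \<subseteq> A \<union> (\<Union>q\<in>A. nbrs c (\<not> col) W q)"
  proof
    fix x assume x: "x \<in> W"
    show "x \<in> A \<union> (\<Union>q\<in>A. nbrs c (\<not> col) W q)"
    proof (rule ccontr)
      assume *: "\<not> ?thesis"
      then have "clique c col (insert x A)"
        using x A(2) by (auto simp: clique_def nbrs_def insert_commute)
      then have "card (insert x A) \<le> card A" using A x by simp
      then show False using * fA by simp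
    qed
  qed
  have "\<exists>q\<in>A. (n + 1) ^ b \<le> card (nbrs c (\<not> col) W q)"
  proof (rule ccontr)
    \<comment> \<open>The 1 saved in each neighbourhood pays for the vertices of \<open>A\<close>
      themselves in the count of \<open>W\<close>.\<close>
    assume "\<not> ?thesis"
    then have small: "card (nbrs c (\<not> col) W q) \<le> (n + 1) ^ b - 1" if "q \<in> A" for q
      using that by fastforce
    have "card W \<le> card (A \<union> (\<Union>q\<in>A. nbrs c (\<not> col) W q))"
      by (rule card_mono) (use sub fA Suc.prems(1) in auto)
    also have "\<dots> \<le> card A + (\<Sum>q\<in>A. card (nbrs c (\<not> col) W q))"
      using card_Un_le[of A "\<Union>q\<in>A. nbrs c (\<not> col) W q"] card_UN_le[OF fA, of "nbrs c (\<not> col) W"]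
      by linarith
    also have "\<dots> \<le> card A + card A * ((n + 1) ^ b - 1)"
      using sum_bounded_above[of A "\<lambda>q. card (nbrs c (\<not> col) W q)", OF small] by simp
    also have "\<dots> = card A * (n + 1) ^ b"
      by (simp add: algebra_simps)
    also have "\<dots> \<le> n * (n + 1) ^ b" using cA by simp
    also have "\<dots> < (n + 1) ^ Suc b" by simp
    finally show False using Suc.prems(3) by simp
  qed
  then obtain q where q: "q \<in> A" "(n + 1) ^ b \<le> card (nbrs c (\<not> col) W q)" by blast
  let ?W = "nbrs c (\<not> col) W q"
  have "?W \<subseteq> W" by (auto simp: nbrs_def)
  then obtain Q where Q: "Q \<subseteq> ?W" "card Q = b + 1" "clique c (\<not> col) Q"
    using Suc.IH[of ?W] Suc.prems(1,2) q(2) by (meson finite_nbrs subset_trans)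
  have "q \<notin> Q" using Q(1) by (auto simp: nbrs_def)
  moreover have "finite Q" using Q(2) card.infinite by fastforce
  ultimately have "card (insert q Q) = Suc b + 1" using Q(2) by simp
  moreover have "clique c (\<not> col) (insert q Q)"
    using Q(1,3) by (auto simp: clique_def nbrs_def insert_commute subset_iff)
  moreover have "insert q Q \<subseteq> W" using Q(1) \<open>?W \<subseteq> W\<close> q(1) A(1) by blast
  ultimately show ?case by blast
qed

section \<open>Ramsey numbers\<close>

text \<open>The least \<open>N\<close> is meaningful only once some \<open>N\<close> works. Here
  \<open>(m + 1) ^ m\<close> does, with \<open>m = card V\<close>: it forces a clique on more than
  \<open>m\<close> vertices in some colour, which contains every graph on \<open>m\<close>
  vertices.\<close>

lemma ramsey_number_works:
  assumes "simple_graph V E"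
  shows "\<exists>col. mono_copy (ramsey_number V E) c V E col"
proof -
  let ?m = "card V" and ?S = "{..<(card V + 1) ^ card V}"
  have "\<exists>col. copy_in c col ?S V E" for c
  proof (cases "\<exists>Q\<subseteq>?S. clique c True Q \<and> card Q > ?m")
    case True
    then show ?thesis
      using clique_copy_in[OF assms] by (meson finite_lessThan finite_subset less_imp_le)
  next
    case False
    then have "\<exists>Q\<subseteq>?S. card Q = ?m + 1 \<and> clique c (\<not> True) Q"
      by (intro clique_or_clique[where n = ?m]) (auto simp: not_less)
    then show ?thesis
      using clique_copy_in[OF assms] by (metis finite_lessThan finite_subset le_add1)
  qed
  then have "\<forall>c. \<exists>col. mono_copy ((?m + 1) ^ ?m) c V E col"
    by (simp add: mono_copy_iff_copy_in)
  from LeastI[of "\<lambda>N. \<forall>c. \<exists>col. mono_copy N c V E col", OF this] show ?thesis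
    by (simp add: ramsey_number_def)
qed

text \<open>The colouring is pulled back along an injection \<open>g\<close> of an initial segment
  into \<open>S\<close>, and the copy found there is composed with \<open>g\<close>.\<close>

lemma ramsey_number_copy_in:
  assumes "simple_graph V E" "finite S" "ramsey_number V E \<le> card S"
  shows "\<exists>col. copy_in c col S V E"
proof -
  obtain g where g: "inj_on g {..<ramsey_number V E}" "g ` {..<ramsey_number V E} \<subseteq> S"
    using card_le_inj[of "{..<ramsey_number V E}" S] assms by auto
  obtain col f where f: "inj_on f V" "f ` V \<subseteq> {..<ramsey_number V E}"
    "\<forall>e\<in>E. c (g ` f ` e) = col"
    using ramsey_number_works[OF assms(1), of "\<lambda>e. c (g ` e)"] by (auto simp: mono_copy_def)
  have "inj_on (g \<circ> f) V" using f g by (meson comp_inj_on inj_on_subset)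
  moreover have "(g \<circ> f) ` V \<subseteq> S" using f g by auto
  moreover have "\<forall>e\<in>E. c ((g \<circ> f) ` e) = col" using f(3) by (simp add: image_comp)
  ultimately show ?thesis unfolding copy_in_def by blast
qed

lemma card_le_ramsey_number:
  assumes "simple_graph V E"
  shows "card V \<le> ramsey_number V E"
proof -
  obtain f where "inj_on f V" "f ` V \<subseteq> {..<ramsey_number V E}"
    using ramsey_number_works[OF assms, of "\<lambda>_. True"] by (auto simp: mono_copy_def)
  then show ?thesis using card_inj_on_le[of f V "{..<ramsey_number V E}"] by simp
qed

section \<open>Greedy embedding of a degenerate graph\<close>

text \<open>Vertices are peeled off one by one, each with at most \<open>D\<close> neighbours among
  those left, and embedded in reverse order. A new vertex must avoid the places already used and the
  wrong-coloured neighbourhoods of at most \<open>D\<close> places, fewer than \<open>card S\<close>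
  places in all.\<close>

lemma greedy_embedding:
  assumes G: "simple_graph V E"
    and deg: "\<And>U. U \<subseteq> V \<Longrightarrow> U \<noteq> {} \<Longrightarrow> \<exists>x\<in>U. card {y\<in>U. {x, y} \<in> E} \<le> D"
    and S: "finite S" "\<And>p. p \<in> S \<Longrightarrow> card (nbrs c (\<not> col) S p) \<le> \<Delta>"
    and card_S: "D * \<Delta> + card V \<le> card S"
  shows "copy_in c col S V E"
proof -
  have "\<exists>f. inj_on f U \<and> f ` U \<subseteq> S \<and> (\<forall>e\<in>E. e \<subseteq> U \<longrightarrow> c (f ` e) = col)"
    if "U \<subseteq> V" for U
    using finite_subset[OF that simple_graph_finite[OF G]] that
  proof (induction U rule: finite_psubset_induct)
    case (psubset U)
    show ?case
    proof (cases "U = {}")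
      case True
      then show ?thesis using G by (auto simp: simple_graph_def)
    next
      case False
      then obtain x where x: "x \<in> U" "card {y\<in>U. {x, y} \<in> E} \<le> D"
        using deg psubset.prems by blast
      then obtain f where f: "inj_on f (U - {x})" "f ` (U - {x}) \<subseteq> S"
        "\<forall>e\<in>E. e \<subseteq> U - {x} \<longrightarrow> c (f ` e) = col"
        using psubset.IH[of "U - {x}"] psubset.prems by blast
      let ?N = "{y\<in>U. {x, y} \<in> E}"
      have xN: "x \<notin> ?N" using G by (auto simp: simple_graph_def)
      have fN: "finite ?N" using psubset.hyps by simp
      \<comment> \<open>The places forbidden for \<open>x\<close>: those in use, and those joined in
        the wrong colour to the image of a neighbour of \<open>x\<close>.\<close>
      let ?F = "f ` (U - {x}) \<union> (\<Union>y\<in>?N. nbrs c (\<not> col) S (f y))"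
      have "card ?F \<le> card (f ` (U - {x})) + card (\<Union>y\<in>?N. nbrs c (\<not> col) S (f y))"
        by (rule card_Un_le)
      also have "\<dots> \<le> (card U - 1) + (\<Sum>y\<in>?N. card (nbrs c (\<not> col) S (f y)))"
        using card_image_le[of "U - {x}" f] card_UN_le[OF fN] psubset.hyps x(1)
        by (intro add_mono) auto
      also have "(\<Sum>y\<in>?N. card (nbrs c (\<not> col) S (f y))) \<le> of_nat (card ?N) * \<Delta>"
        by (rule sum_bounded_above, rule S(2)) (use f(2) xN in blast)
      also have "\<dots> \<le> D * \<Delta>" using x(2) by simp
      finally have "card ?F \<le> card U - 1 + D * \<Delta>" by simp
      moreover have "card U \<le> card V" "card U > 0"
        using psubset x(1) card_mono[OF simple_graph_finite[OF G]] by (auto simp: card_gt_0_iff)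
      ultimately have "card ?F < card S" using card_S by linarith
      then have "\<not> S \<subseteq> ?F"
        using card_mono[of ?F S] psubset.hyps fN S(1) by fastforce
      then obtain p where p: "p \<in> S" "p \<notin> ?F" by blast
      let ?f = "f(x := p)"
      have "inj_on ?f (insert x (U - {x}))"
        using p(2) by (intro inj_on_fun_updI inj_on_insert[THEN iffD2] conjI) (use f(1) in \<open>auto simp: inj_on_def\<close>)
      then have "inj_on ?f U" using x(1) by (simp add: insert_absorb)
      moreover have "?f ` U \<subseteq> S" using f(2) p(1) by auto
      moreover have "c (?f ` e) = col" if e: "e \<in> E" "e \<subseteq> U" for e
      proof (cases "x \<in> e")
        case False
        then have "?f ` e = f ` e" by auto
        then show ?thesis using f(3) e False by auto
      next
        case True
        obtain a b where ab: "e = {a, b}" "a \<noteq> b"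
          using simple_graph_edge[OF G e(1)] by metis
        then obtain y where y: "e = {x, y}" "y \<noteq> x"
          using True by (metis insertE insert_commute singletonD)
        then have "y \<in> ?N" using e by auto
        then have "p \<notin> nbrs c (\<not> col) S (f y)" "p \<noteq> f y" using p(2) y(2) by blast+
        then have "c {f y, p} = col" using p(1) by (auto simp: nbrs_def)
        then show ?thesis using y by (simp add: insert_commute)
      qed
      ultimately show ?thesis by blast
    qed
  qed
  from this[of V] show ?thesis
    using G unfolding copy_in_def simple_graph_def by (metis order_refl)
qed

section \<open>Lower bound for the Ramsey number by counting colourings\<close>

lemma min_degree_le_edges:
  assumes G: "simple_graph V E" and U: "U \<subseteq> V"
    and deg: "\<And>x. x \<in> U \<Longrightarrow> D \<le> card {y\<in>U. {x, y} \<in> E}"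
  shows "D * card U \<le> 2 * card {e\<in>E. e \<subseteq> U}"
proof -
  let ?E = "{e\<in>E. e \<subseteq> U}"
  have fU: "finite U" using U simple_graph_finite[OF G] finite_subset by blast
  then have fE: "finite ?E" by (metis (no_types, lifting) finite_Pow_iff finite_subset mem_Collect_eq Pow_iff subsetI)
  have "card {x\<in>U. x \<in> e} = 2" if "e \<in> ?E" for e
  proof -
    have "{x\<in>U. x \<in> e} = e" using that by auto
    then show ?thesis using that G by (auto simp: simple_graph_def)
  qed
  then have "(\<Sum>x\<in>U. card {e\<in>?E. x \<in> e}) = (\<Sum>e\<in>?E. 2)"
    by (intro sum_multicount_gen[OF fU fE]) blast
  moreover have "D \<le> card {e\<in>?E. x \<in> e}" if x: "x \<in> U" for x
  proof -
    have "inj_on (\<lambda>y. {x, y}) {y\<in>U. {x, y} \<in> E}"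
      by (auto simp: inj_on_def doubleton_eq_iff)
    then have "card {y\<in>U. {x, y} \<in> E} \<le> card {e\<in>?E. x \<in> e}"
      by (rule card_inj_on_le) (use x in \<open>auto intro: finite_subset[OF _ fE]\<close>)
    then show ?thesis using deg[OF x] by simp
  qed
  then have "of_nat (card U) * D \<le> (\<Sum>x\<in>U. card {e\<in>?E. x \<in> e})"
    by (intro sum_bounded_below) blast
  ultimately show ?thesis by (simp add: mult.commute)
qed

text \<open>With \<open>P\<close> the edges of a complete graph and \<open>A\<close> the set of
  edges of colour \<open>True\<close>, this counts the colourings that give all of \<open>F\<close>
  the colour \<open>True\<close>; the next lemma does the same for \<open>False\<close>.\<close>

lemma card_supersets:
  assumes "finite P" "F \<subseteq> P"
  shows "card {A\<in>Pow P. F \<subseteq> A} = 2 ^ (card P - card F)"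
proof -
  have "bij_betw (\<lambda>A. A \<union> F) (Pow (P - F)) {A\<in>Pow P. F \<subseteq> A}"
    by (rule bij_betw_byWitness[where f' = "\<lambda>A. A - F"]) (use assms in auto)
  then have "card {A\<in>Pow P. F \<subseteq> A} = card (Pow (P - F))"
    by (simp add: bij_betw_same_card)
  then show ?thesis
    using assms by (simp add: card_Pow card_Diff_subset finite_subset)
qed

lemma card_disjoint_subsets:
  assumes "finite P" "F \<subseteq> P"
  shows "card {A\<in>Pow P. F \<inter> A = {}} = 2 ^ (card P - card F)"
proof -
  have "{A\<in>Pow P. F \<inter> A = {}} = Pow (P - F)" by auto
  then show ?thesis
    using assms by (simp add: card_Pow card_Diff_subset finite_subset)
qed

text \<open>The union bound over all copies, with a colouring encoded as the set of edges of colour True.\<close>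

lemma edges_le_if_ramsey:
  assumes G: "simple_graph V E" and U: "U \<subseteq> V"
    and r: "\<And>c. \<exists>col. mono_copy r c V E col"
  shows "2 ^ card {e\<in>E. e \<subseteq> U} \<le> 2 * r ^ card U"
proof -
  let ?E = "{e\<in>E. e \<subseteq> U}"
  let ?P = "{e. e \<subseteq> {..<r} \<and> card e = 2}"
  \<comment> \<open>Only the part of the graph inside \<open>U\<close> is counted, so that the
    exponent of \<open>r\<close> is \<open>card U\<close>. Extensional maps make the set of
    injections finite.\<close>
  let ?I = "{f \<in> U \<rightarrow>\<^sub>E {..<r}. inj_on f U}"
  let ?F = "\<lambda>f. (`) f ` ?E"
  let ?X = "\<lambda>f. {A\<in>Pow ?P. ?F f \<subseteq> A} \<union> {A\<in>Pow ?P. ?F f \<inter> A = {}}"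
  have fU: "finite U" using U simple_graph_finite[OF G] finite_subset by blast
  have fP: "finite ?P" by (rule finite_subset[of _ "Pow {..<r}"]) auto
  have fI: "finite ?I" using fU by (simp add: finite_PiE)
  have cI: "card ?I \<le> r ^ card U"
    using card_mono[of "U \<rightarrow>\<^sub>E {..<r}" ?I] fU by (auto simp: finite_PiE card_PiE)
  have FP: "?F f \<subseteq> ?P" if f: "f \<in> ?I" for f
  proof -
    have "card (f ` e) = 2" if "e \<in> ?E" for e
      using that f G by (subst card_image) (auto simp: simple_graph_def intro: inj_on_subset)
    moreover have "f ` U \<subseteq> {..<r}" using f by auto
    ultimately show ?thesis by blast
  qed
  have cF: "card (?F f) = card ?E" if "f \<in> ?I" for f
    using that by (intro card_image) (auto simp: inj_on_def inj_on_image_eq_iff)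
  have cX: "card (?X f) \<le> 2 * 2 ^ (card ?P - card ?E)" if f: "f \<in> ?I" for f
    using card_Un_le[of "{A\<in>Pow ?P. ?F f \<subseteq> A}" "{A\<in>Pow ?P. ?F f \<inter> A = {}}"]
    unfolding card_supersets[OF fP FP[OF f]] card_disjoint_subsets[OF fP FP[OF f]] cF[OF f]
    by simp
  have cover: "\<exists>f\<in>?I. A \<in> ?X f" if A: "A \<subseteq> ?P" for A
  proof -
    obtain col f where f: "inj_on f V" "f ` V \<subseteq> {..<r}" "\<forall>e\<in>E. (f ` e \<in> A) = col"
      using r[of "\<lambda>e. e \<in> A"] by (auto simp: mono_copy_def)
    let ?f = "restrict f U"
    have "inj_on f U" "f ` U \<subseteq> {..<r}" using f U by (auto intro: inj_on_subset)
    then have "?f \<in> ?I" by (auto simp: inj_on_def)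
    moreover have "?f ` e = f ` e" if "e \<in> ?E" for e
      using that by (intro image_cong) auto
    then have "?F ?f = ?F f" by (intro image_cong) auto
    then have "A \<in> ?X ?f" using f(3) A by (cases col) auto
    ultimately show ?thesis by blast
  qed
  have sub: "Pow ?P \<subseteq> (\<Union>f\<in>?I. ?X f)"
  proof
    fix A assume "A \<in> Pow ?P"
    then show "A \<in> (\<Union>f\<in>?I. ?X f)" using cover[OF PowD] by (simp only: UN_iff)
  qed
  \<comment> \<open>One injection suffices to see that the subtraction
    \<open>card ?P - card ?E\<close> is not truncated.\<close>
  obtain f0 where "f0 \<in> ?I" using cover[OF empty_subsetI] by (elim bexE)
  then have EP: "card ?E \<le> card ?P"
    using card_mono[OF fP FP[of f0]] cF[of f0] by linarith
  have "2 ^ card ?P = card (Pow ?P)" using fP by (simp add: card_Pow)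
  also have "\<dots> \<le> card (\<Union>f\<in>?I. ?X f)"
    by (rule card_mono[OF _ sub]) (use fI fP in auto)
  also have "\<dots> \<le> (\<Sum>f\<in>?I. card (?X f))" by (rule card_UN_le[OF fI])
  also have "\<dots> \<le> of_nat (card ?I) * (2 * 2 ^ (card ?P - card ?E))"
    by (rule sum_bounded_above[OF cX])
  also have "\<dots> \<le> r ^ card U * (2 * 2 ^ (card ?P - card ?E))" using cI by simp
  finally have "2 ^ card ?P \<le> r ^ card U * (2 * 2 ^ (card ?P - card ?E))" .
  moreover have "(2::nat) ^ card ?P = 2 ^ card ?E * 2 ^ (card ?P - card ?E)"
    using EP by (simp flip: power_add)
  ultimately show ?thesis by (simp add: ac_simps)
qed

text \<open>There are at least \<open>D * card U / 2\<close> edges inside \<open>U\<close>. The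
  factor 2 in the counting bound is at most \<open>r ^ card U\<close>, so squaring gives exponent
  \<open>4 * card U\<close>; then the \<open>card U\<close>-th root is taken.\<close>

lemma min_degree_le_ramsey:
  assumes G: "simple_graph V E" and U: "U \<subseteq> V" "U \<noteq> {}"
    and deg: "\<And>x. x \<in> U \<Longrightarrow> D \<le> card {y\<in>U. {x, y} \<in> E}"
    and r: "\<And>c. \<exists>col. mono_copy r c V E col" "2 \<le> r"
  shows "2 ^ D \<le> r ^ 4"
proof -
  let ?m = "card U" and ?e = "card {e\<in>E. e \<subseteq> U}"
  have m: "?m > 0"
    using U simple_graph_finite[OF G] by (metis card_gt_0_iff finite_subset)
  have "(2 ^ D) ^ ?m = (2::nat) ^ (D * ?m)" by (simp add: power_mult)
  also have "\<dots> \<le> 2 ^ (2 * ?e)"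
    using min_degree_le_edges[OF G U(1) deg] by (intro power_increasing) auto
  also have "\<dots> = (2 ^ ?e) ^ 2" by (metis mult.commute power_mult)
  also have "\<dots> \<le> (2 * r ^ ?m) ^ 2"
    by (rule power_mono[OF edges_le_if_ramsey[OF G U(1) r(1)]]) simp
  also have "\<dots> \<le> (r ^ ?m * r ^ ?m) ^ 2"
  proof (intro power_mono mult_mono)
    show "2 \<le> r ^ ?m" using r(2) m self_le_power[of r ?m] by linarith
  qed auto
  also have "\<dots> = (r ^ 4) ^ ?m"
    by (simp flip: power_add power_mult)
  finally show ?thesis using m by (simp add: power_mono_iff)
qed

section \<open>Extending copies by one vertex, and sparsity of one colour\<close>

lemma copy_in_nbrs_extend:
  assumes G: "simple_graph V E" and v: "v \<in> V" and u: "u \<in> S"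
    and H: "copy_in c col (nbrs c col S u) (V - {v}) (delete_vertex_edges E v)"
  shows "copy_in c col S V E"
proof -
  obtain f where f: "inj_on f (V - {v})" "f ` (V - {v}) \<subseteq> nbrs c col S u"
    "\<forall>e\<in>delete_vertex_edges E v. c (f ` e) = col"
    using H by (auto simp: copy_in_def)
  let ?f = "f(v := u)"
  have fu: "f x \<in> S" "f x \<noteq> u" "c {u, f x} = col" if "x \<in> V" "x \<noteq> v" for x
    using f(2) that by (auto simp: nbrs_def)
  have "inj_on ?f V" using f(1) fu unfolding inj_on_def by (metis Diff_iff fun_upd_apply singletonD)
  moreover have "?f ` V \<subseteq> S" using fu u by auto
  moreover have "c (?f ` e) = col" if e: "e \<in> E" for e
  proof (cases "v \<in> e")
    case False
    then have "?f ` e = f ` e" by auto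
    then show ?thesis using f(3) e False by (auto simp: delete_vertex_edges_def)
  next
    case True
    obtain a b where ab: "e = {a, b}" "a \<noteq> b" "a \<in> V" "b \<in> V"
      using simple_graph_edge[OF G e] by metis
    then show ?thesis using True fu by (auto simp: insert_commute)
  qed
  ultimately show ?thesis unfolding copy_in_def by blast
qed

lemma card_nbrs_sum:
  assumes "finite S" "x \<in> S"
  shows "card (nbrs c col S x) + card (nbrs c (\<not> col) S x) + 1 = card S"
proof -
  have "S = insert x (nbrs c col S x \<union> nbrs c (\<not> col) S x)"
    using assms by (auto simp: nbrs_def)
  moreover have "x \<notin> nbrs c col S x \<union> nbrs c (\<not> col) S x" by (auto simp: nbrs_def)
  moreover have "card (nbrs c col S x \<union> nbrs c (\<not> col) S x)
      = card (nbrs c col S x) + card (nbrs c (\<not> col) S x)"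
    by (rule card_Un_disjoint) (use assms in \<open>auto simp: nbrs_def\<close>)
  ultimately show ?thesis
    using assms(1) by (metis Suc_eq_plus1 card_insert_disjoint finite_UnI finite_nbrs)
qed

text \<open>Let \<open>d\<close> be the maximum red (\<open>True\<close>) degree, attained at
  \<open>u\<close>, and \<open>N = card S\<close>. All red neighbourhoods contain that of
  \<open>u\<close> up to at most \<open>r\<close> vertices, and double counting yields
  \<open>d * (N - d) \<le> N * r\<close>. Hence the smaller of \<open>d\<close> and
  \<open>N - d\<close> is at most \<open>2 * r\<close>. If it is \<open>N - d\<close>, the blue
  degrees are bounded through red degrees of at least \<open>d - r\<close>.\<close>

lemma one_colour_sparse:
  assumes S: "finite S"
    and small: "\<And>u w. u \<in> S \<Longrightarrow> w \<in> S \<Longrightarrow> u \<noteq> w \<Longrightarrow> card (nbrs c True S u \<inter> nbrs c False S w) < r"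
  shows "\<exists>col. \<forall>u\<in>S. card (nbrs c col S u) \<le> 3 * r"
proof (cases "S = {}")
  case False
  let ?R = "nbrs c True S" and ?B = "nbrs c False S"
  define d where "d = Max ((\<lambda>u. card (?R u)) ` S)"
  have "d \<in> (\<lambda>u. card (?R u)) ` S" unfolding d_def using S False by (intro Max_in) auto
  then obtain u where u: "u \<in> S" "card (?R u) = d" by auto
  have d: "card (?R w) \<le> d" if "w \<in> S" for w
    unfolding d_def using S that by auto
  have common: "d \<le> card (?R u \<inter> ?R w) + r" if w: "w \<in> S" for w
  proof (cases "u = w")
    case True
    then show ?thesis using u by simp
  next
    case False
    \<comment> \<open>The vertex \<open>w\<close> lies in neither of its own neighbourhoods; this
      extra 1 is absorbed by the strict bound in \<open>small\<close>.\<close>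
    have "?R u \<subseteq> (?R u \<inter> ?R w) \<union> insert w (?R u \<inter> ?B w)" by (auto simp: nbrs_def)
    then have "d \<le> card ((?R u \<inter> ?R w) \<union> insert w (?R u \<inter> ?B w))"
      unfolding u(2)[symmetric] by (rule card_mono[rotated]) (use S in auto)
    also have "\<dots> \<le> card (?R u \<inter> ?R w) + Suc (card (?R u \<inter> ?B w))"
      using card_Un_le[of "?R u \<inter> ?R w" "insert w (?R u \<inter> ?B w)"]
        card_insert_le_m1[of "Suc (card (?R u \<inter> ?B w))" "?R u \<inter> ?B w" w]
      by simp
    finally show ?thesis using small[OF u(1) w False] by linarith
  qed
  let ?N = "card S"
  \<comment> \<open>Pairs of \<open>w\<close> in \<open>S\<close> and a common red neighbour
    \<open>x\<close> of \<open>u\<close> and \<open>w\<close>: at least \<open>d - r\<close> for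
    each \<open>w\<close>, at most \<open>d\<close> for each \<open>x\<close>.\<close>
  have "?N * (d - r) \<le> (\<Sum>w\<in>S. card {x \<in> ?R u. x \<in> ?R w})"
  proof -
    have "d - r \<le> card {x \<in> ?R u. x \<in> ?R w}" if "w \<in> S" for w
      using common[OF that] by (simp add: Int_def)
    then show ?thesis using sum_bounded_below[of S "d - r"] by fastforce
  qed
  also have "\<dots> = (\<Sum>x\<in>?R u. card {w\<in>S. x \<in> ?R w})"
    by (rule sum_multicount_gen) (use S in auto)
  also have "\<dots> \<le> (\<Sum>x\<in>?R u. d)"
  proof (rule sum_mono)
    fix x assume "x \<in> ?R u"
    then have x: "x \<in> S" by (simp add: nbrs_def)
    have "{w\<in>S. x \<in> ?R w} = ?R x" using x by (auto simp: nbrs_def insert_commute)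
    then show "card {w\<in>S. x \<in> ?R w} \<le> d" using d[OF x] by simp
  qed
  also have "\<dots> = d * d" using u by simp
  finally have "?N * (d - r) \<le> d * d" .
  then have key: "?N * d \<le> d * d + ?N * r"
    by (cases "r \<le> d") (auto simp: diff_mult_distrib2 trans_le_add2)
  show ?thesis
  proof (cases "2 * d \<le> ?N")
    case True
    then have "2 * d * d \<le> ?N * d" by simp
    then have "?N * d \<le> ?N * (2 * r)" using key by linarith
    moreover have "0 < ?N" using S False by (simp add: card_gt_0_iff)
    ultimately have "d \<le> 2 * r" by simp
    then show ?thesis using d by (intro exI[of _ True]) fastforce
  next
    case nle: False
    have "d \<le> ?N" using card_mono[OF S, of "?R u"] u by (auto simp: nbrs_def)
    then obtain k where k: "?N = d + k" using le_Suc_ex by blast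
    then have "k \<le> d" using nle by simp
    have "d * k \<le> (d + k) * r" using key unfolding k by (simp add: algebra_simps)
    also have "\<dots> \<le> (d + d) * r" using \<open>k \<le> d\<close> by (intro mult_le_mono) auto
    also have "\<dots> = d * (2 * r)" by simp
    finally have "d * k \<le> d * (2 * r)" .
    moreover have "d > 0" using nle by simp
    ultimately have "k \<le> 2 * r" by simp
    have "card (?B w) \<le> 3 * r" if w: "w \<in> S" for w
    proof -
      have "card (?R u \<inter> ?R w) \<le> card (?R w)" using S by (intro card_mono) auto
      then have "d \<le> card (?R w) + r" using common[OF w] by linarith
      moreover have "card (?R w) + card (?B w) + 1 = d + k"
        using card_nbrs_sum[OF S w, of c True] k by simp
      ultimately show ?thesis using \<open>k \<le> 2 * r\<close> by linarith
    qed
    then show ?thesis by blast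
  qed
qed simp

section \<open>Exchange argument in a maximum clique of the dense colour\<close>

text \<open>A set of at most \<open>t\<close> elements is listed and padded with \<open>None\<close>
  to length exactly \<open>t\<close>.\<close>

lemma card_small_subsets:
  assumes "finite A"
  shows "card {T. T \<subseteq> A \<and> card T \<le> t} \<le> (card A + 1) ^ t"
proof -
  let ?L = "{xs. set xs \<subseteq> insert None (Some ` A) \<and> length xs = t}"
  have fin: "finite (insert None (Some ` A))" using assms by simp
  have "{T. T \<subseteq> A \<and> card T \<le> t} \<subseteq> (\<lambda>xs. {a. Some a \<in> set xs}) ` ?L"
  proof safe
    fix T assume T: "T \<subseteq> A" "card T \<le> t"
    then obtain ys where ys: "set ys = T" "length ys = card T"
      using finite_distinct_list[of T] assms distinct_card finite_subset by metis
    let ?xs = "map Some ys @ replicate (t - card T) None"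
    have "{a. Some a \<in> set ?xs} = T" using ys by auto
    moreover have "?xs \<in> ?L" using ys T by auto
    ultimately show "T \<in> (\<lambda>xs. {a. Some a \<in> set xs}) ` ?L" by blast
  qed
  then have "card {T. T \<subseteq> A \<and> card T \<le> t} \<le> card ((\<lambda>xs. {a. Some a \<in> set xs}) ` ?L)"
    by (rule card_mono[rotated]) (intro finite_imageI finite_lists_length_eq fin)
  also have "\<dots> \<le> card ?L" by (intro card_image_le finite_lists_length_eq fin)
  also have "\<dots> = (card A + 1) ^ t"
    using assms by (subst card_lists_length_eq[OF fin]) (simp add: card_image)
  finally show ?thesis .
qed

lemma pigeonhole_card:
  assumes "finite P" "finite Y" "g ` P \<subseteq> Y" "card Y \<le> k" "k * m \<le> card P" "0 < card P"
  shows "\<exists>y\<in>Y. m \<le> card {x\<in>P. g x = y}"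
proof (rule ccontr)
  assume "\<not> ?thesis"
  then have small: "card {x\<in>P. g x = y} \<le> m - 1" "m > 0" if "y \<in> Y" for y
    using that by fastforce+
  obtain y0 where "y0 \<in> Y" using assms by (auto simp: card_gt_0_iff)
  then have "m > 0" "card Y > 0" using small(2) assms(2) by (auto simp: card_gt_0_iff)
  have "P = (\<Union>y\<in>Y. {x\<in>P. g x = y})" using assms(3) by auto
  then have "card P \<le> (\<Sum>y\<in>Y. card {x\<in>P. g x = y})"
    using card_UN_le[OF assms(2), of "\<lambda>y. {x\<in>P. g x = y}"] by simp
  also have "\<dots> \<le> of_nat (card Y) * (m - 1)" by (rule sum_bounded_above[OF small(1)])
  also have "\<dots> < card Y * m" using \<open>m > 0\<close> \<open>card Y > 0\<close> by simp
  also have "\<dots> \<le> k * m" using assms(4) by simp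
  finally show False using assms(5) by simp
qed

text \<open>Many vertices outside a maximum clique A of the dense colour have the same set T of at most
  t neighbours of the sparse colour in A.  A dense clique of size t + 1 among them could replace T.\<close>

lemma sparse_colour_clique_bound:
  assumes S: "finite S" "card S = K * r"
    and sparse: "\<And>p. p \<in> S \<Longrightarrow> card (nbrs c col S p) \<le> 3 * r"
    and noclique: "\<And>Q b. Q \<subseteq> S \<Longrightarrow> clique c b Q \<Longrightarrow> card Q \<le> n"
    and nr: "0 < n" "n \<le> r" and K: "4 \<le> K"
  shows "r < (n + 1) ^ (2 * (6 * n div K))"
proof (rule ccontr)
  assume neg: "\<not> ?thesis"
  define t where "t = 6 * n div K"
  \<comment> \<open>One factor pays for the pigeonhole over the sets \<open>T\<close>, the other for
    finding a clique on \<open>t + 1\<close> vertices.\<close>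
  have r: "(n + 1) ^ t * (n + 1) ^ t \<le> r"
    using neg by (simp add: t_def mult_2 power_add not_less)
  have "6 * n < (t + 1) * K"
    unfolding t_def using K by (metis Suc_eq_plus1 dividend_less_div_times mult.commute mult_Suc add.commute gr0I not_numeral_le_zero)
  obtain A where A: "A \<subseteq> S" "clique c (\<not> col) A"
    "\<And>B. B \<subseteq> S \<Longrightarrow> clique c (\<not> col) B \<Longrightarrow> card B \<le> card A"
    using maximum_clique[OF S(1)] by metis
  have fA: "finite A" using A(1) S(1) finite_subset by blast
  have cA: "card A \<le> n" using noclique A by blast
  let ?g = "\<lambda>x. {a\<in>A. a \<in> nbrs c col S x}"
  define bad where "bad = {x\<in>S. t < card (?g x)}"
  have bS: "bad \<subseteq> S" "finite bad" using S(1) by (auto simp: bad_def)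
  \<comment> \<open>Sparse edges between \<open>bad\<close> and \<open>A\<close> are counted from
    both sides; the choice of \<open>t\<close> then leaves at most half of \<open>S\<close>
    bad.\<close>
  have "of_nat (card bad) * (t + 1) \<le> (\<Sum>x\<in>bad. card (?g x))"
    by (rule sum_bounded_below) (auto simp: bad_def)
  also have "\<dots> = (\<Sum>a\<in>A. card {x\<in>bad. a \<in> nbrs c col S x})"
    by (rule sum_multicount_gen) (use bS fA in auto)
  also have "\<dots> \<le> of_nat (card A) * (3 * r)"
  proof (rule sum_bounded_above)
    fix a assume a: "a \<in> A"
    have "{x\<in>bad. a \<in> nbrs c col S x} \<subseteq> nbrs c col S a"
      using bS(1) by (auto simp: nbrs_def insert_commute)
    then have "card {x\<in>bad. a \<in> nbrs c col S x} \<le> card (nbrs c col S a)"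
      by (rule card_mono[rotated]) (simp add: S)
    then show "card {x\<in>bad. a \<in> nbrs c col S x} \<le> 3 * r"
      using sparse a A(1) by (meson order_trans subsetD)
  qed
  also have "\<dots> \<le> n * (3 * r)" using cA by simp
  finally have b1: "card bad * (t + 1) \<le> n * (3 * r)" by simp
  have "card bad * (6 * n) \<le> card bad * ((t + 1) * K)"
    using \<open>6 * n < (t + 1) * K\<close> by (intro mult_le_mono2) simp
  also have "\<dots> \<le> n * (3 * r) * K" using mult_le_mono1[OF b1, of K] by (simp only: mult.assoc)
  finally have "3 * n * (2 * card bad) \<le> 3 * n * (K * r)" by (simp add: ac_simps)
  then have b2: "2 * card bad \<le> K * r" using nr(1) by simp
  define P where "P = S - A - bad"
  \<comment> \<open>At least \<open>K * r / 2 - n \<ge> 2 * r - r = r\<close> vertices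
    remain.\<close>
  have "card P \<ge> card S - card A - card bad"
    unfolding P_def using diff_card_le_card_Diff[OF fA, of S] diff_card_le_card_Diff[OF bS(2), of "S - A"]
    by linarith
  moreover have "4 * r \<le> K * r" using K by simp
  ultimately have cP: "r \<le> card P" using b2 S(2) cA nr(2) by linarith
  have fP: "finite P" using S(1) by (simp add: P_def)
  let ?Y = "{T. T \<subseteq> A \<and> card T \<le> t}"
  have "\<exists>T\<in>?Y. (n + 1) ^ t \<le> card {x\<in>P. ?g x = T}"
  proof (rule pigeonhole_card[OF fP])
    show "finite ?Y" using fA by simp
    show "?g ` P \<subseteq> ?Y" by (auto simp: P_def bad_def)
    show "card ?Y \<le> (n + 1) ^ t"
      using card_small_subsets[OF fA, of t] power_mono[of "card A + 1" "n + 1" t] cA by linarith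
    show "(n + 1) ^ t * (n + 1) ^ t \<le> card P" using r cP by linarith
    show "0 < card P" using cP nr by linarith
  qed
  then obtain T where T: "T \<subseteq> A" "card T \<le> t" "(n + 1) ^ t \<le> card {x\<in>P. ?g x = T}" by blast
  have "\<exists>Q\<subseteq>{x\<in>P. ?g x = T}. card Q = t + 1 \<and> clique c (\<not> col) Q"
  proof (rule clique_or_clique[OF _ _ T(3)])
    show "finite {x\<in>P. ?g x = T}" using fP by simp
    show "card Q \<le> n" if "Q \<subseteq> {x\<in>P. ?g x = T}" "clique c col Q" for Q
      using that noclique[of Q] by (auto simp: P_def)
  qed
  then obtain Q where Q: "Q \<subseteq> {x\<in>P. ?g x = T}" "card Q = t + 1" "clique c (\<not> col) Q" by blast
  have QP: "Q \<subseteq> S" "Q \<inter> A = {}" using Q(1) by (auto simp: P_def)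
  \<comment> \<open>All sparse neighbours of \<open>x\<close> in \<open>A\<close> lie in
    \<open>T\<close>, so its edges to the rest of \<open>A\<close> have the dense colour.\<close>
  have cross: "c {x, y} = (\<not> col)" "c {y, x} = (\<not> col)" if "x \<in> Q" "y \<in> A - T" for x y
  proof -
    have "?g x = T" "y \<in> S" "y \<noteq> x" using that Q(1) QP A(1) by auto
    then have "y \<notin> nbrs c col S x" using that by auto
    then show "c {x, y} = (\<not> col)" using \<open>y \<in> S\<close> \<open>y \<noteq> x\<close> by (auto simp: nbrs_def)
    then show "c {y, x} = (\<not> col)" by (simp add: insert_commute)
  qed
  have "clique c (\<not> col) (A - T \<union> Q)"
    unfolding clique_def
  proof (intro ballI impI)
    fix x y assume "x \<in> A - T \<union> Q" "y \<in> A - T \<union> Q" "x \<noteq> y"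
    then consider "x \<in> A" "y \<in> A" | "x \<in> Q" "y \<in> Q" | "x \<in> Q" "y \<in> A - T" | "y \<in> Q" "x \<in> A - T"
      by blast
    then show "c {x, y} = (\<not> col)"
    proof cases
      case 1
      then show ?thesis using A(2) \<open>x \<noteq> y\<close> unfolding clique_def by blast
    next
      case 2
      then show ?thesis using Q(3) \<open>x \<noteq> y\<close> unfolding clique_def by blast
    next
      case 3
      then show ?thesis by (rule cross(1))
    next
      case 4
      then show ?thesis by (rule cross(2))
    qed
  qed
  moreover have "A - T \<union> Q \<subseteq> S" using A(1) QP(1) by blast
  \<comment> \<open>At most \<open>t\<close> vertices leave \<open>A\<close> and
    \<open>t + 1\<close> enter, against maximality.\<close>
  ultimately have "card (A - T \<union> Q) \<le> card A" by (rule A(3)[rotated])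
  moreover have "card (A - T \<union> Q) = card A - card T + (t + 1)"
  proof -
    have "finite Q" using Q(2) card.infinite by fastforce
    then show ?thesis using QP(2) fA T(1) Q(2)
      by (subst card_Un_disjoint) (auto simp: card_Diff_subset finite_subset)
  qed
  moreover have "card T \<le> card A" using T(1) fA by (simp add: card_mono)
  ultimately show False using T(2) by linarith
qed

section \<open>The two bounds and their contradiction\<close>

lemma ramsey_bounds_if_no_copy:
  fixes V :: "'a set"
  assumes G: "simple_graph V E" "card V = n + 1" "v \<in> V" "2 \<le> n"
    and r_def: "r = ramsey_number (V - {v}) (delete_vertex_edges E v)"
    and K: "4 \<le> K"
    and no_copy: "\<And>col. \<not> copy_in c col {..<K * r} V E"
  shows "2 ^ (K div 8) \<le> r ^ 4" "r < (n + 1) ^ (2 * (6 * n div K))"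
proof -
  let ?H = "delete_vertex_edges E v" and ?S = "{..<K * r}"
  have fV: "finite V" by (rule simple_graph_finite[OF G(1)])
  have H: "simple_graph (V - {v}) ?H"
    using G(1) by (auto simp: simple_graph_def delete_vertex_edges_def)
  have nr: "n \<le> r"
    using card_le_ramsey_number[OF H] G(2,3) fV by (simp add: r_def)
  have "card (nbrs c True ?S u \<inter> nbrs c False ?S w) < r"
    if "u \<in> ?S" "w \<in> ?S" for u w
  proof (rule ccontr)
    let ?X = "nbrs c True ?S u \<inter> nbrs c False ?S w"
    assume "\<not> card ?X < r"
    then obtain col where "copy_in c col ?X (V - {v}) ?H"
      using ramsey_number_copy_in[OF H, of ?X c] by (auto simp: r_def)
    \<comment> \<open>The set \<open>?X\<close> lies in the red neighbourhood of \<open>u\<close>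
      and in the blue one of \<open>w\<close>, so either colour of the copy has a vertex that
      extends it.\<close>
    then have "copy_in c col (nbrs c col ?S (if col then u else w)) (V - {v}) ?H"
      by (cases col) (auto intro: copy_in_mono)
    then show False
      using copy_in_nbrs_extend[OF G(1,3)] no_copy that by (cases col) (metis (full_types))+
  qed
  then obtain col where sparse: "\<And>p. p \<in> ?S \<Longrightarrow> card (nbrs c col ?S p) \<le> 3 * r"
    using one_colour_sparse[of ?S c r] by auto
  show "r < (n + 1) ^ (2 * (6 * n div K))"
  proof (rule sparse_colour_clique_bound[OF _ _ sparse])
    show "card Q \<le> n" if "Q \<subseteq> ?S" "clique c b Q" for Q b
    proof (rule ccontr)
      assume "\<not> card Q \<le> n"
      then have "card V \<le> card Q" using G(2) by simp
      with clique_copy_in[OF G(1) that(2) _ _ that(1)] that(1) no_copy show False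
        by (meson finite_lessThan finite_subset)
    qed
  qed (use nr G K in auto)
  \<comment> \<open>This choice makes \<open>3 * ?D + 2 \<le> K\<close>, which leaves room for the
    greedy embedding because \<open>card V \<le> 2 * r\<close>.\<close>
  let ?D = "K div 8"
  have "\<exists>U\<subseteq>V. U \<noteq> {} \<and> (\<forall>x\<in>U. ?D < card {y\<in>U. {x, y} \<in> E})"
  proof (rule ccontr)
    assume nex: "\<not> ?thesis"
    have "copy_in c (\<not> col) ?S V E"
    proof (rule greedy_embedding[OF G(1)])
      show "\<exists>x\<in>U. card {y\<in>U. {x, y} \<in> E} \<le> ?D" if "U \<subseteq> V" "U \<noteq> {}" for U
        using nex that by (meson not_le_imp_less)
      show "card (nbrs c (\<not> \<not> col) ?S p) \<le> 3 * r" if "p \<in> ?S" for p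
        using sparse[OF that] by simp
      have "?D * (3 * r) + card V \<le> ?D * (3 * r) + 2 * r" using G(2,4) nr by simp
      also have "\<dots> = (3 * ?D + 2) * r" by (simp add: algebra_simps)
      also have "\<dots> \<le> K * r" using K by (intro mult_le_mono) auto
      finally show "?D * (3 * r) + card V \<le> card ?S" by simp
    qed simp
    then show False using no_copy by blast
  qed
  \<comment> \<open>The strict inequality matters: deleting \<open>v\<close> lowers each degree by
    at most 1, so \<open>U - {v}\<close> still has minimum degree at least
    \<open>?D\<close>.\<close>
  then obtain U where U: "U \<subseteq> V" "U \<noteq> {}" "\<And>x. x \<in> U \<Longrightarrow> ?D < card {y\<in>U. {x, y} \<in> E}"
    by blast
  have fU: "finite U" using U(1) fV finite_subset by blast
  have noloop: "{x} \<notin> E" for x using G(1) by (auto simp: simple_graph_def)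
  show "2 ^ ?D \<le> r ^ 4"
  proof (rule min_degree_le_ramsey[OF H])
    show "U - {v} \<subseteq> V - {v}" using U(1) by auto
    show "U - {v} \<noteq> {}"
    proof
      assume "U - {v} = {}"
      then have "U = {v}" using U(2) by blast
      then have "{y\<in>U. {v, y} \<in> E} = {}" using noloop by auto
      then show False using U(3)[of v] unfolding \<open>{y\<in>U. {v, y} \<in> E} = {}\<close> using \<open>U = {v}\<close> by simp
    qed
    show "?D \<le> card {y\<in>U - {v}. {x, y} \<in> ?H}" if "x \<in> U - {v}" for x
    proof -
      have "{y\<in>U. {x, y} \<in> E} \<subseteq> insert v {y\<in>U - {v}. {x, y} \<in> ?H}"
        using that by (auto simp: delete_vertex_edges_def)
      then have "card {y\<in>U. {x, y} \<in> E} \<le> card (insert v {y\<in>U - {v}. {x, y} \<in> ?H})"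
        by (rule card_mono[rotated]) (use fU in simp)
      also have "\<dots> \<le> Suc (card {y\<in>U - {v}. {x, y} \<in> ?H})"
        using fU by (simp add: card_insert_if)
      finally show ?thesis using U(3)[of x] that by simp
    qed
    show "\<exists>col. mono_copy r c (V - {v}) ?H col" for c
      unfolding r_def by (rule ramsey_number_works[OF H])
    show "2 \<le> r" using nr G(4) by simp
  qed
qed

text \<open>With \<open>L = log 2 n\<close>, logarithms give
  \<open>K / 8 - 1 \<le> 96 * n * L / K\<close>. As \<open>K \<ge> 40\<close>, the left side is at
  least \<open>K / 16\<close>, so the square of \<open>K\<close> is at most
  \<open>1536 * n * L\<close>; the factor 40 in \<open>K\<close> makes it at least
  \<open>1600 * n * L\<close>.\<close>

lemma bounds_contradict:
  fixes n K r :: nat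
  assumes n: "2 \<le> n" and K: "K = nat \<lceil>40 * sqrt (real n * log 2 (real n))\<rceil>"
    and 1: "2 ^ (K div 8) \<le> r ^ 4" and 2: "r < (n + 1) ^ (2 * (6 * n div K))"
  shows False
proof -
  define L where "L = log 2 (real n)"
  have L: "1 \<le> L" unfolding L_def using n by simp
  have nL: "2 \<le> real n * L" using n L mult_mono[of 2 "real n" 1 L] by simp
  have Kge: "40 * sqrt (real n * L) \<le> real K"
    unfolding K L_def by linarith
  have "1 \<le> sqrt (real n * L)" using nL by simp
  then have K40: "40 \<le> real K" using Kge by linarith
  have "(40 * sqrt (real n * L))\<^sup>2 \<le> (real K)\<^sup>2"
    using Kge nL by (intro power_mono) auto
  then have Ksq: "1600 * (real n * L) \<le> (real K)\<^sup>2" using nL by (simp add: power_mult_distrib)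
  let ?t = "6 * n div K"
  have "2 ^ (K div 8) \<le> ((n + 1) ^ (2 * ?t)) ^ 4"
    using 1 2 by (meson less_imp_le order_trans power_mono zero_le)
  also have "\<dots> \<le> ((n ^ 2) ^ (2 * ?t)) ^ 4"
  proof (intro power_mono)
    have "2 * n \<le> n * n" using n by simp
    then show "n + 1 \<le> n ^ 2" using n unfolding power2_eq_square by linarith
  qed auto
  also have "\<dots> = n ^ (16 * ?t)" by (simp flip: power_mult)
  finally have "real (2 ^ (K div 8)) \<le> real (n ^ (16 * ?t))" by linarith
  then have "log 2 (2 ^ (K div 8)) \<le> log 2 (real n ^ (16 * ?t))"
    using n by (subst log_le_cancel_iff) auto
  then have A: "real (K div 8) \<le> 16 * real ?t * L"
    using n by (simp add: log_nat_power L_def)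
  have "K < 8 * (K div 8) + 8" by linarith
  then have B: "real K / 8 - 1 \<le> real (K div 8)" by linarith
  have "real ?t \<le> 6 * real n / real K" using of_nat_div_le_of_nat[of "6 * n" K] by simp
  then have "16 * real ?t * L \<le> 16 * (6 * real n / real K) * L"
    using L by (intro mult_right_mono mult_left_mono) auto
  then have "real K / 8 - 1 \<le> 96 * (real n * L) / real K" using A B by simp
  moreover have "real K / 16 \<le> real K / 8 - 1" using K40 by simp
  ultimately have "real K / 16 \<le> 96 * (real n * L) / real K" by linarith
  then have "(real K)\<^sup>2 \<le> 1536 * (real n * L)"
    using K40 by (simp add: field_simps power2_eq_square)
  then show False using Ksq nL by linarith
qed

theorem theorem1p3:
  shows "\<exists>C::real. C > 0 \<and>
    (\<forall>(V::nat set) E v n. simple_graph V E \<longrightarrow> card V = n + 1 \<longrightarrow> v \<in> V \<longrightarrow> n \<ge> 2 \<longrightarrow>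
       real (ramsey_number V E)
         \<le> C * sqrt (real n * log 2 (real n)) * real (ramsey_number (V - {v}) (delete_vertex_edges E v)))"
proof (intro exI[of _ 41] conjI allI impI)
  fix V :: "nat set" and E v n
  assume G: "simple_graph V E" "card V = n + 1" "v \<in> V" "n \<ge> 2"
  define r where "r = ramsey_number (V - {v}) (delete_vertex_edges E v)"
  define s where "s = sqrt (real n * log 2 (real n))"
  define K where "K = nat \<lceil>40 * s\<rceil>"
  have "1 \<le> log 2 (real n)" using G(4) by simp
  then have "1 * 1 \<le> real n * log 2 (real n)" using G(4) by (intro mult_mono) auto
  then have s: "1 \<le> s" by (simp add: s_def)
  \<comment> \<open>Rounding up adds at most \<open>1 \<le> s\<close>, whence the constant
    41.\<close>
  then have K: "4 \<le> K" "real K \<le> 41 * s" unfolding K_def by linarith+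
  have "\<exists>col. copy_in c col {..<K * r} V E" for c
  proof (rule ccontr)
    assume "\<not> ?thesis"
    then have "\<not> copy_in c col {..<K * r} V E" for col by blast
    from bounds_contradict[OF G(4) K_def[unfolded s_def] ramsey_bounds_if_no_copy[OF G r_def K(1) this]]
    show False .
  qed
  then have "ramsey_number V E \<le> K * r"
    unfolding ramsey_number_def mono_copy_iff_copy_in by (intro Least_le) blast
  then have "real (ramsey_number V E) \<le> real K * real r"
    by (metis of_nat_le_iff of_nat_mult)
  also have "\<dots> \<le> 41 * s * real r" using K(2) by (intro mult_right_mono) auto
  finally show "real (ramsey_number V E)
      \<le> 41 * sqrt (real n * log 2 (real n)) * real (ramsey_number (V - {v}) (delete_vertex_edges E v))"
    by (simp add: s_def r_def)
qed simp

end
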